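(* Let $G$ be a bipartite multigraph and let $H$ be a subgraph of $G$ such that $E(H)$ is a clique in $L(G)^2$. Then $|E(H)| \leq \Delta(H)\bigl(\sigma_G(H)-\Delta(H)\bigr) \leq \frac{1}{4}\sigma_G(H)^2$, where $\sigma_G(H)=\max_{xy\in E(H)}(d_G(x)+d_G(y))$.
   Context: For a (multi)graph $G$, $L(G)^2$ denotes the square of the line graph of $G$: its vertices are the edges of $G$, and two distinct edges $e,f$ of $G$ are adjacent in $L(G)^2$ if and only if they share an end, or some edge of $G$ joins an end of $e$ to an end of $f$. A set of edges is a clique in $L(G)^2$ if its elements are pairwise adjacent in $L(G)^2$. Degrees in a multigraph count multiplicity; $\Delta(H)$ is the maximum degree of $H$. $\sigma_G(H)$ is the Ore-degree of $H$ in $G$ (taken to be $0$ if $H$ has no edges). *)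

theory Defs
  imports Complex_Main
begin

(* Edges are abstract objects, so parallel edges are distinct elements of the edge set with the
   same pair of ends. *)
record ('v, 'e) mgraph =
  verts :: "'v set"
  edges :: "'e set"
  ends :: "'e \<Rightarrow> 'v set"

(* Finite and loopless; bipartite multigraphs have no loops in any case. *)
definition multigraph :: "('v, 'e) mgraph \<Rightarrow> bool" where
  "multigraph G \<longleftrightarrow> finite (verts G) \<and> finite (edges G) \<and>
     (\<forall>e\<in>edges G. ends G e \<subseteq> verts G \<and> card (ends G e) = 2)"

definition bipartite :: "('v, 'e) mgraph \<Rightarrow> bool" where
  "bipartite G \<longleftrightarrow> (\<exists>A B. A \<union> B = verts G \<and> A \<inter> B = {} \<and>
     (\<forall>e\<in>edges G. \<exists>a\<in>A. \<exists>b\<in>B. ends G e = {a, b}))"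

definition subgraph :: "('v, 'e) mgraph \<Rightarrow> ('v, 'e) mgraph \<Rightarrow> bool" where
  "subgraph H G \<longleftrightarrow> multigraph H \<and> multigraph G \<and>
     verts H \<subseteq> verts G \<and> edges H \<subseteq> edges G \<and> (\<forall>e\<in>edges H. ends H e = ends G e)"

definition degree :: "('v, 'e) mgraph \<Rightarrow> 'v \<Rightarrow> nat" where
  "degree G v = card {e \<in> edges G. v \<in> ends G e}"

(* The maximum degree of the graph without vertices is 0 by convention. *)
definition max_degree :: "('v, 'e) mgraph \<Rightarrow> nat" where
  "max_degree G = (if verts G = {} then 0 else Max (degree G ` verts G))"

definition ore_degree :: "('v, 'e) mgraph \<Rightarrow> ('v, 'e) mgraph \<Rightarrow> nat" where
  "ore_degree G H = (if edges H = {} then 0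
     else Max {degree G x + degree G y | x y. \<exists>e\<in>edges H. ends H e = {x, y}})"

(* Adjacency in the square of the line graph of G. *)
definition line_square_adj :: "('v, 'e) mgraph \<Rightarrow> 'e \<Rightarrow> 'e \<Rightarrow> bool" where
  "line_square_adj G e f \<longleftrightarrow> e \<in> edges G \<and> f \<in> edges G \<and> e \<noteq> f \<and>
     (ends G e \<inter> ends G f \<noteq> {} \<or>
      (\<exists>g\<in>edges G. \<exists>x\<in>ends G e. \<exists>y\<in>ends G f. ends G g = {x, y}))"

definition line_square_clique :: "('v, 'e) mgraph \<Rightarrow> 'e set \<Rightarrow> bool" where
  "line_square_clique G S \<longleftrightarrow> S \<subseteq> edges G \<and> pairwise (line_square_adj G) S"

end

theory Submission imports Defs begin

text \<open>Let \<open>a\<close> be a vertex of maximum degree \<open>D\<close> in \<open>H\<close>, let \<open>N\<close> and \<open>M\<close> be its neighbourhoods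
  in \<open>H\<close> and \<open>G\<close>, and let \<open>s\<close> be the Ore-degree.  Each \<open>b \<in> N\<close> has degree at most \<open>s - d(a)\<close> in
  \<open>G\<close>, and \<open>M - N\<close> has at most \<open>d(a) - D\<close> elements, each of degree at most \<open>D\<close> in \<open>H\<close>.  If no other
  edges of \<open>H\<close> existed (and \<open>G\<close> were simple), this would give \<open>D (s - d(a)) + D (d(a) - D) = D (s - D)\<close>.
  An edge of \<open>H\<close> that misses \<open>M\<close> must have its other end \<open>x\<close> joined in \<open>G\<close> to all of \<open>N\<close>; since \<open>x\<close>
  has degree at most \<open>D\<close> in \<open>H\<close>, such edges at \<open>x\<close> are compensated by the edges between \<open>x\<close> and
  \<open>N\<close> that lie in \<open>G\<close> but not in \<open>H\<close>, which the first bound has counted superfluously.\<close>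

lemma card_fibres_le:
  assumes "finite S" and "\<And>y. y \<in> S \<Longrightarrow> card {e \<in> F. f e = y} \<le> k"
  shows "card {e \<in> F. f e \<in> S} \<le> card S * k"
proof -
  have "{e \<in> F. f e \<in> S} = (\<Union>y\<in>S. {e \<in> F. f e = y})" by auto
  then have "card {e \<in> F. f e \<in> S} \<le> (\<Sum>y\<in>S. card {e \<in> F. f e = y})"
    using card_UN_le[OF assms(1)] by metis
  also have "\<dots> \<le> card S * k"
    using sum_bounded_above[of S "\<lambda>y. card {e \<in> F. f e = y}" k] assms(2) by simp
  finally show ?thesis .
qed

text \<open>Adding the first three inequalities cancels \<open>g\<close> and \<open>g'\<close> and
  leaves \<open>f1 + f3\<close> at most \<open>n * r + (D - n) * x\<close>, hence at most
  \<open>D * r\<close> as \<open>x \<le> r\<close>. The bounds on \<open>f2\<close> and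
  \<open>c\<close> add at most \<open>D * (d - D)\<close>.\<close>

lemma charging_arith:
  fixes f1 f2 f3 g g' h n x r D c d s :: nat
  assumes "f1 + g' \<le> n * r" and "n * x \<le> g + g'" and "f3 + g \<le> x * D" and "f2 \<le> c * D"
    and "c + D \<le> d" and "x \<le> r" and "n \<le> D" and "r + d = s"
  shows "f1 + f2 + f3 + D * D \<le> D * s"
proof -
  obtain t where D: "D = n + t" using assms(7) le_Suc_ex by blast
  have "n * r + t * x \<le> D * r" using assms(6) by (simp add: D distrib_right)
  moreover have "x * D = n * x + t * x" by (simp add: D algebra_simps)
  moreover have "c * D + D * D \<le> D * d"
    using mult_le_mono2[OF assms(5), of D] by (simp add: distrib_left mult.commute[of c])
  moreover have "D * s = D * r + D * d" using assms(8) by (simp flip: distrib_left)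
  ultimately show ?thesis
    using assms(1-4) by linarith
qed

text \<open>The edges of a bipartite multigraph are encoded by their end \<open>p e\<close> in one part and their end
  \<open>q e\<close> in the other.\<close>

lemma bipartite_clique_bound:
  assumes fin: "finite E" and FE: "F \<subseteq> E"
    and clique: "\<And>e f. e \<in> F \<Longrightarrow> f \<in> F \<Longrightarrow>
      \<exists>g\<in>E. p g = p e \<and> q g = q f \<or> p g = p f \<and> q g = q e"
    and ore: "\<And>e. e \<in> F \<Longrightarrow> card {g \<in> E. p g = p e} + card {g \<in> E. q g = q e} \<le> s"
    and degp: "\<And>x. card {e \<in> F. p e = x} \<le> D"
    and degq: "\<And>y. card {e \<in> F. q e = y} \<le> D"
    and deg_a: "card {e \<in> F. p e = a} = D"
  shows "card F + D * D \<le> D * s"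
proof (cases "D = 0")
  case True
  have finF: "finite F" using fin FE by (rule finite_subset[rotated])
  then have "F = {}" using degp True by fastforce
  then show ?thesis using True by simp
next
  case False
  have finF: "finite F" using fin FE by (rule finite_subset[rotated])
  \<comment> \<open>The end \<open>q e0\<close> of such an edge lies in \<open>N\<close>; it will
    bound \<open>card X\<close> and show \<open>d \<le> s\<close>, so that \<open>s - d\<close> is
    not truncated.\<close>
  have "{e \<in> F. p e = a} \<noteq> {}" using False deg_a by (metis card.empty)
  then obtain e0 where e0: "e0 \<in> F" "p e0 = a" by blast
  define N where "N = q ` {e \<in> F. p e = a}"
  define M where "M = q ` {e \<in> E. p e = a}"
  define d where "d = card {e \<in> E. p e = a}"
  define F1 where "F1 = {e \<in> F. q e \<in> N}"
  define F2 where "F2 = {e \<in> F. q e \<in> M - N}"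
  define F3 where "F3 = {e \<in> F. q e \<notin> M}"
  define X where "X = p ` F3"
  \<comment> \<open>\<open>K \<inter> F\<close> shares with \<open>F3\<close> the degree bound
    \<open>D\<close> at \<open>X\<close>, while \<open>K - F\<close> is the surplus in the degree
    count at \<open>N\<close>.\<close>
  define K where "K = {e \<in> E. q e \<in> N \<and> p e \<in> X}"
  have NM: "N \<subseteq> M" using FE by (auto simp: N_def M_def)
  have finN: "finite N" and finM: "finite M" using finF fin by (auto simp: N_def M_def)
  have finX: "finite X" using finF by (auto simp: X_def F3_def)
  have finK: "finite K" using fin by (auto simp: K_def)
  have split: "card F = card F1 + card F2 + card F3"
  proof -
    have "F = (F1 \<union> F2) \<union> F3" using NM by (auto simp: F1_def F2_def F3_def)
    moreover have "card ((F1 \<union> F2) \<union> F3) = card (F1 \<union> F2) + card F3"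
      using finF NM by (intro card_Un_disjoint) (auto simp: F1_def F2_def F3_def)
    moreover have "card (F1 \<union> F2) = card F1 + card F2"
      using finF by (intro card_Un_disjoint) (auto simp: F1_def F2_def)
    ultimately show ?thesis by simp
  qed
  have joined: "\<exists>g\<in>E. p g = x \<and> q g = b" if x: "x \<in> X" and b: "b \<in> N" for x b
  proof -
    obtain f where f: "f \<in> F3" "x = p f" using x by (auto simp: X_def)
    obtain e where e: "e \<in> F" "p e = a" "b = q e" using b by (auto simp: N_def)
    \<comment> \<open>The clique condition for \<open>e\<close> and \<open>f\<close> offers an edge
      from \<open>a\<close> to \<open>q f\<close> or one from \<open>x\<close> to \<open>b\<close>;
      the former would put \<open>q f\<close> into \<open>M\<close>.\<close>
    have "q g \<in> M" if "g \<in> E" "p g = a" for g using that by (auto simp: M_def)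
    then have "\<not> (\<exists>g\<in>E. p g = a \<and> q g = q f)"
      using f(1) by (metis (lifting) F3_def mem_Collect_eq)
    then show ?thesis using clique[of e f] e f by (auto simp: F3_def)
  qed
  have degN: "card {g \<in> E. q g = b} + d \<le> s" if "b \<in> N" for b
    using that ore by (fastforce simp: N_def d_def)
  have b0: "q e0 \<in> N" using e0 by (auto simp: N_def)
  have "X \<subseteq> p ` {g \<in> E. q g = q e0}" using joined[OF _ b0] by force
  then have "card X \<le> card {g \<in> E. q g = q e0}" using fin by (intro surj_card_le) auto
  then have x_le: "card X \<le> s - d" and d_le: "d \<le> s" using degN[OF b0] by linarith+
  have n_le: "card N \<le> D"
    using card_image_le[of "{e \<in> F. p e = a}" q] finF deg_a by (simp add: N_def)
  have c_le: "card (M - N) + D \<le> d"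
  proof -
    \<comment> \<open>A vertex of \<open>M - N\<close> is reached from \<open>a\<close> only by
      edges outside \<open>F\<close>.\<close>
    have "card (M - N) \<le> card ({e \<in> E. p e = a} - {e \<in> F. p e = a})"
      by (rule surj_card_le[where f = q]) (use fin in \<open>auto simp: M_def N_def\<close>)
    also have "\<dots> = d - D"
      using FE finF by (subst card_Diff_subset) (auto simp: d_def deg_a)
    moreover have "D \<le> d"
      unfolding d_def deg_a[symmetric] using fin FE by (intro card_mono) auto
    ultimately show ?thesis by linarith
  qed
  have f2_le: "card F2 \<le> card (M - N) * D"
    unfolding F2_def by (rule card_fibres_le) (use finM degq in auto)
  have f3_le: "card F3 + card (K \<inter> F) \<le> card X * D"
  proof -
    have "card F3 + card (K \<inter> F) = card (F3 \<union> (K \<inter> F))"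
      using finF NM by (intro card_Un_disjoint[symmetric]) (auto simp: F3_def K_def)
    also have "\<dots> \<le> card {e \<in> F. p e \<in> X}"
      using finF by (intro card_mono) (auto simp: X_def F3_def K_def)
    also have "\<dots> \<le> card X * D"
      by (rule card_fibres_le) (use finX degp in auto)
    finally show ?thesis .
  qed
  have K_ge: "card N * card X \<le> card (K \<inter> F) + card (K - F)"
  proof -
    have "card (X \<times> N) \<le> card K"
      by (rule surj_card_le[where f = "\<lambda>e. (p e, q e)"])
        (use finK joined in \<open>fastforce simp: K_def image_iff\<close>)+
    moreover have "card K = card (K \<inter> F) + card (K - F)"
      using finK by (rule card_Int_Diff)
    ultimately show ?thesis by (simp add: card_cartesian_product mult.commute)
  qed
  have f1_le: "card F1 + card (K - F) \<le> card N * (s - d)"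
  proof -
    \<comment> \<open>Both sets consist of edges of \<open>E\<close> ending in \<open>N\<close>,
      where degrees are at most \<open>s - d\<close>.\<close>
    have "card F1 + card (K - F) = card (F1 \<union> (K - F))"
      using finF finK by (intro card_Un_disjoint[symmetric]) (auto simp: F1_def)
    also have "\<dots> \<le> card {e \<in> E. q e \<in> N}"
      using fin FE by (intro card_mono) (auto simp: F1_def K_def)
    also have "\<dots> \<le> card N * (s - d)"
      by (rule card_fibres_le) (use finN degN in \<open>auto simp: le_diff_conv2 d_le\<close>)
    finally show ?thesis .
  qed
  show ?thesis
    unfolding split
    by (rule charging_arith[OF f1_le K_ge f3_le f2_le c_le x_le n_le]) (use d_le in simp)
qed

lemma degree_le_max_degree:
  assumes "multigraph H"
  shows "degree H v \<le> max_degree H"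
proof (cases "v \<in> verts H")
  case True
  then show ?thesis using assms by (auto simp: max_degree_def multigraph_def)
next
  case False
  then have none: "{e \<in> edges H. v \<in> ends H e} = {}" using assms by (auto simp: multigraph_def)
  show ?thesis unfolding degree_def none by simp
qed

lemma ore_degree_ge:
  assumes "finite (edges G)" and "e \<in> edges H" and "ends H e = {x, y}"
  shows "degree G x + degree G y \<le> ore_degree G H"
proof -
  let ?S = "{degree G x + degree G y | x y. \<exists>e\<in>edges H. ends H e = {x, y}}"
  have "degree G u \<le> card (edges G)" for u
    unfolding degree_def using assms(1) by (intro card_mono) auto
  \<comment> \<open>Finiteness is needed for \<open>Max\<close> to be an upper bound.\<close>
  then have "?S \<subseteq> {..card (edges G) + card (edges G)}" by (auto intro: add_mono)
  then have "finite ?S" by (rule finite_subset) simp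
  moreover have "degree G x + degree G y \<in> ?S" using assms by blast
  ultimately show ?thesis using assms(2) by (auto simp: ore_degree_def intro: Max_ge)
qed

text \<open>Only the side containing the vertex of maximum degree is distinguished, so the other
  case follows by exchanging \<open>A\<close> and \<open>B\<close>.\<close>

lemma strong_clique_bound:
  assumes sub: "subgraph H G" and clq: "line_square_clique G (edges H)"
    and AB: "A \<inter> B = {}" and bip: "\<forall>e\<in>edges G. \<exists>a\<in>A. \<exists>b\<in>B. ends G e = {a, b}"
    and v: "v \<in> A" "degree H v = max_degree H"
  shows "card (edges H) + max_degree H * max_degree H \<le> max_degree H * ore_degree G H"
proof -
  obtain p q where pq: "\<And>e. e \<in> edges G \<Longrightarrow> p e \<in> A \<and> q e \<in> B \<and> ends G e = {p e, q e}"
    using bip by metis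
  have H: "multigraph H" and G: "multigraph G" and HG: "edges H \<subseteq> edges G"
    and endsH: "\<And>e. e \<in> edges H \<Longrightarrow> ends H e = ends G e"
    using sub by (auto simp: subgraph_def)
  have fin: "finite (edges G)" using G by (simp add: multigraph_def)
  have GA: "{e \<in> edges G. p e = x} = {e \<in> edges G. x \<in> ends G e}"
    and HA: "{e \<in> edges H. p e = x} = {e \<in> edges H. x \<in> ends H e}" if "x \<in> A" for x
    using that pq AB HG endsH by fastforce+
  have GB: "{e \<in> edges G. q e = x} = {e \<in> edges G. x \<in> ends G e}"
    and HB: "{e \<in> edges H. q e = x} = {e \<in> edges H. x \<in> ends H e}" if "x \<in> B" for x
    using that pq AB HG endsH by fastforce+
  show ?thesis
  proof (rule bipartite_clique_bound[where E = "edges G" and p = p and q = q and a = v])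
    show "finite (edges G)" "edges H \<subseteq> edges G" by fact+
  next
    fix e f assume ef: "e \<in> edges H" "f \<in> edges H"
    then have eG: "e \<in> edges G" and fG: "f \<in> edges G" using HG by auto
    show "\<exists>g\<in>edges G. p g = p e \<and> q g = q f \<or> p g = p f \<and> q g = q e"
    proof (cases "e = f \<or> p e = p f \<or> q e = q f")
      case True
      \<comment> \<open>Here \<open>e\<close> or \<open>f\<close> itself serves as
        \<open>g\<close>.\<close>
      then show ?thesis using eG fG by metis
    next
      case False
      then have "line_square_adj G e f"
        using clq ef by (auto simp: line_square_clique_def pairwise_def)
      moreover have "ends G e \<inter> ends G f = {}" using False pq[OF eG] pq[OF fG] AB by auto
      ultimately obtain g x y where g: "g \<in> edges G" "x \<in> ends G e" "y \<in> ends G f"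
          "ends G g = {x, y}"
        by (auto simp: line_square_adj_def)
      have xy: "x = p e \<or> x = q e" "y = p f \<or> y = q f"
        using g pq[OF eG] pq[OF fG] by auto
      \<comment> \<open>As \<open>g\<close> has one end in each part, it joins \<open>p e\<close> to
        \<open>q f\<close> or \<open>p f\<close> to \<open>q e\<close>.\<close>
      have "{p g, q g} = {x, y}" using g pq by simp
      then have "p g = p e \<and> q g = q f \<or> p g = p f \<and> q g = q e"
        using xy pq[OF eG] pq[OF fG] pq[OF g(1)] AB unfolding doubleton_eq_iff by auto
      then show ?thesis using g(1) by blast
    qed
  next
    fix e assume e: "e \<in> edges H"
    then have "e \<in> edges G" using HG by auto
    then show "card {g \<in> edges G. p g = p e} + card {g \<in> edges G. q g = q e} \<le> ore_degree G H"
      using ore_degree_ge[OF fin e, of "p e" "q e"] pq[of e] endsH[OF e] GA[of "p e"] GB[of "q e"]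
      by (simp add: degree_def)
  next
    fix x
    show "card {e \<in> edges H. p e = x} \<le> max_degree H"
    proof (cases "x \<in> A")
      case True
      then show ?thesis using degree_le_max_degree[OF H, of x] HA by (simp add: degree_def)
    next
      case False
      then have none: "{e \<in> edges H. p e = x} = {}" using pq HG by blast
      show ?thesis unfolding none by simp
    qed
  next
    fix x
    show "card {e \<in> edges H. q e = x} \<le> max_degree H"
    proof (cases "x \<in> B")
      case True
      then show ?thesis using degree_le_max_degree[OF H, of x] HB by (simp add: degree_def)
    next
      case False
      then have none: "{e \<in> edges H. q e = x} = {}" using pq HG by blast
      show ?thesis unfolding none by simp
    qed
  next
    show "card {e \<in> edges H. p e = v} = max_degree H"
      using v HA by (simp add: degree_def)
  qed
qed

theorem theorem4:
  fixes G H :: "('v, 'e) mgraph"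
  assumes "multigraph G"
    and "bipartite G"
    and "subgraph H G"
    and "line_square_clique G (edges H)"
  shows "real (card (edges H))
           \<le> real (max_degree H) * (real (ore_degree G H) - real (max_degree H))
       \<and> real (max_degree H) * (real (ore_degree G H) - real (max_degree H))
           \<le> 1 / 4 * (real (ore_degree G H))\<^sup>2"
proof
  let ?D = "max_degree H" and ?s = "ore_degree G H"
  have H: "multigraph H" and VH: "verts H \<subseteq> verts G"
    using assms(3) by (auto simp: subgraph_def)
  \<comment> \<open>The additive form avoids truncated subtraction on the naturals.\<close>
  have "card (edges H) + ?D * ?D \<le> ?D * ?s"
  proof (cases "verts H = {}")
    case True
    then have "edges H = {}" using H by (fastforce simp: multigraph_def)
    then show ?thesis using True by (simp add: max_degree_def)
  next
    case False
    have "finite (verts H)" using H by (simp add: multigraph_def)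
    then have "?D \<in> degree H ` verts H" using False by (simp add: max_degree_def)
    then obtain v where v: "v \<in> verts H" "degree H v = ?D" by auto
    obtain A B where AB: "A \<union> B = verts G" "A \<inter> B = {}"
      and bip: "\<forall>e\<in>edges G. \<exists>a\<in>A. \<exists>b\<in>B. ends G e = {a, b}"
      using assms(2) by (auto simp: bipartite_def)
    have bip': "\<forall>e\<in>edges G. \<exists>b\<in>B. \<exists>a\<in>A. ends G e = {b, a}"
      using bip by (metis insert_commute)
    have BA: "B \<inter> A = {}" using AB by auto
    consider "v \<in> A" | "v \<in> B" using v VH AB by auto
    then show ?thesis
    proof cases
      case 1
      show ?thesis by (rule strong_clique_bound[OF assms(3,4) AB(2) bip 1 v(2)])
    next
      case 2
      show ?thesis by (rule strong_clique_bound[OF assms(3,4) BA bip' 2 v(2)])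
    qed
  qed
  then have "real (card (edges H) + ?D * ?D) \<le> real (?D * ?s)" by (rule of_nat_mono)
  then show "real (card (edges H)) \<le> real ?D * (real ?s - real ?D)"
    by (simp add: right_diff_distrib)
  have "0 \<le> (real ?s - 2 * real ?D)\<^sup>2" by simp
  then show "real ?D * (real ?s - real ?D) \<le> 1 / 4 * (real ?s)\<^sup>2"
    by (simp add: power2_eq_square algebra_simps)
qed

end
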